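(* Let $T$ be a complete first-order theory in a countable language with monster model $M$. Suppose that $p\in S_1(\emptyset)$ is non-isolated and that $D_1,D_2\subseteq M$ are $\bar e$-definable sets such that: (1) $\overline{SI}_p\cap(D_1\times D_2)\neq\emptyset$ and it is relatively $\bar e$-definable within $D_1\times D_2$ (i.e. $\overline{SI}_p\cap(D_1\times D_2)=E\cap(D_1\times D_2)$ for some $\bar e$-definable $E\subseteq M^2$); (2) for all $a\in D_1\cap p(M)$ there is $b\in D_2\cap p(M)$ such that $a\mapsto b$; (3) for all $b\in D_2\cap p(M)$ there is $a\in D_1\cap p(M)$ such that $b\to a$. Then there is an $\bar e$-definable quasi-order $\leq$ on $M$ such that for no $a\in D_1\cap p(M)$ is there an element $c\in D_1$ with $a\leq c$ and $c$ maximal in $D_1$ with respect to $\leq$. In particular, $T$ has the strict order property.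
   Context: Write $a\to b$ if there is an $L$-formula $\phi(x,y)$ with $\models\phi(a,b)$ and $\phi(a,y)\vdash\mathrm{tp}(b)$ (semi-isolation); $a\mapsto b$ means $a\to b$ and not $b\to a$. For $p\in S_1(\emptyset)$, $\overline{SI}_p=\{(a,b)\in p(M)^2: a\to b\text{ or } b\to a\}$. *)

theory Defs
  imports "HOL-Library.Countable_Set"
begin

unbundle cardinal_syntax

record ('f, 'r) language =
  Funs :: "'f set"
  Rels :: "'r set"
  fun_arity :: "'f \<Rightarrow> nat"
  rel_arity :: "'r \<Rightarrow> nat"

definition countable_language :: "('f, 'r) language \<Rightarrow> bool" where
  "countable_language L \<longleftrightarrow> countable (Funs L) \<and> countable (Rels L)"

text \<open>Variables are de Bruijn indices into a list of elements; \<open>Exists\<close> binds index 0.\<close>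

datatype 'f trm = Var nat | Fn 'f "'f trm list"

datatype ('f, 'r) form =
    Equal "'f trm" "'f trm"
  | Rel 'r "'f trm list"
  | Neg "('f, 'r) form"
  | Conj "('f, 'r) form" "('f, 'r) form"
  | Exists "('f, 'r) form"

fun is_term :: "('f, 'r) language \<Rightarrow> nat \<Rightarrow> 'f trm \<Rightarrow> bool" where
  "is_term L n (Var i) \<longleftrightarrow> i < n"
| "is_term L n (Fn f ts) \<longleftrightarrow>
     f \<in> Funs L \<and> length ts = fun_arity L f \<and> (\<forall>t\<in>set ts. is_term L n t)"

primrec is_formula :: "('f, 'r) language \<Rightarrow> nat \<Rightarrow> ('f, 'r) form \<Rightarrow> bool" where
  "is_formula L n (Equal s t) \<longleftrightarrow> is_term L n s \<and> is_term L n t"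
| "is_formula L n (Rel r ts) \<longleftrightarrow>
     r \<in> Rels L \<and> length ts = rel_arity L r \<and> (\<forall>t\<in>set ts. is_term L n t)"
| "is_formula L n (Neg \<phi>) \<longleftrightarrow> is_formula L n \<phi>"
| "is_formula L n (Conj \<phi> \<psi>) \<longleftrightarrow> is_formula L n \<phi> \<and> is_formula L n \<psi>"
| "is_formula L n (Exists \<phi>) \<longleftrightarrow> is_formula L (Suc n) \<phi>"

text \<open>\<open>formulas L n\<close> is the set of \<open>L\<close>-formulas with free variables among \<open>0, \<dots>, n - 1\<close>;
  \<open>formulas L 0\<close> is the set of sentences.\<close>

definition formulas :: "('f, 'r) language \<Rightarrow> nat \<Rightarrow> ('f, 'r) form set" where
  "formulas L n = {\<phi>. is_formula L n \<phi>}"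

record ('f, 'r, 'm) struct =
  univ :: "'m set"
  fun_interp :: "'f \<Rightarrow> 'm list \<Rightarrow> 'm"
  rel_interp :: "'r \<Rightarrow> 'm list \<Rightarrow> bool"

definition is_structure :: "('f, 'r) language \<Rightarrow> ('f, 'r, 'm) struct \<Rightarrow> bool" where
  "is_structure L M \<longleftrightarrow> univ M \<noteq> {} \<and>
     (\<forall>f\<in>Funs L. \<forall>xs. set xs \<subseteq> univ M \<and> length xs = fun_arity L f
        \<longrightarrow> fun_interp M f xs \<in> univ M)"

primrec eval :: "('f, 'r, 'm) struct \<Rightarrow> 'm list \<Rightarrow> 'f trm \<Rightarrow> 'm" where
  "eval M xs (Var i) = xs ! i"
| "eval M xs (Fn f ts) = fun_interp M f (map (eval M xs) ts)"

primrec sat :: "('f, 'r, 'm) struct \<Rightarrow> 'm list \<Rightarrow> ('f, 'r) form \<Rightarrow> bool" where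
  "sat M xs (Equal s t) \<longleftrightarrow> eval M xs s = eval M xs t"
| "sat M xs (Rel r ts) \<longleftrightarrow> rel_interp M r (map (eval M xs) ts)"
| "sat M xs (Neg \<phi>) \<longleftrightarrow> \<not> sat M xs \<phi>"
| "sat M xs (Conj \<phi> \<psi>) \<longleftrightarrow> sat M xs \<phi> \<and> sat M xs \<psi>"
| "sat M xs (Exists \<phi>) \<longleftrightarrow> (\<exists>a\<in>univ M. sat M (a # xs) \<phi>)"

definition is_model ::
    "('f, 'r) language \<Rightarrow> ('f, 'r) form set \<Rightarrow> ('f, 'r, 'm) struct \<Rightarrow> bool" where
  "is_model L T M \<longleftrightarrow> is_structure L M \<and> (\<forall>\<sigma>\<in>T. sat M [] \<sigma>)"

text \<open>Logical consequence. HOL cannot quantify over structures on all types. For a countable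
  language the models with universe a subset of \<open>nat\<close> (finite or infinite) suffice, by the
  downward Loewenheim-Skolem theorem.\<close>

definition entails :: "('f, 'r) language \<Rightarrow> ('f, 'r) form set \<Rightarrow> ('f, 'r) form \<Rightarrow> bool" where
  "entails L T \<sigma> \<longleftrightarrow> (\<forall>N :: ('f, 'r, nat) struct. is_model L T N \<longrightarrow> sat N [] \<sigma>)"

definition complete_theory :: "('f, 'r) language \<Rightarrow> ('f, 'r) form set \<Rightarrow> bool" where
  "complete_theory L T \<longleftrightarrow> T \<subseteq> formulas L 0 \<and>
     (\<exists>N :: ('f, 'r, nat) struct. is_model L T N) \<and>
     (\<forall>\<sigma>\<in>formulas L 0. entails L T \<sigma> \<or> entails L T (Neg \<sigma>))"

text \<open>A pair \<open>(\<phi>, as)\<close> stands for the formula \<open>\<phi>(x, as)\<close> with parameters \<open>as\<close>.\<close>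

definition param_formulas ::
    "('f, 'r) language \<Rightarrow> 'm set \<Rightarrow> (('f, 'r) form \<times> 'm list) set" where
  "param_formulas L A = {(\<phi>, as). set as \<subseteq> A \<and> \<phi> \<in> formulas L (Suc (length as))}"

definition saturated ::
    "('f, 'r) language \<Rightarrow> 'k rel \<Rightarrow> ('f, 'r, 'm) struct \<Rightarrow> bool" where
  "saturated L \<kappa> M \<longleftrightarrow>
     (\<forall>A \<subseteq> univ M. |A| <o \<kappa> \<longrightarrow>
       (\<forall>\<Sigma> \<subseteq> param_formulas L A.
          (\<forall>\<Sigma>\<^sub>0 \<subseteq> \<Sigma>. finite \<Sigma>\<^sub>0 \<longrightarrow> (\<exists>c\<in>univ M. \<forall>(\<phi>, as)\<in>\<Sigma>\<^sub>0. sat M (c # as) \<phi>)) \<longrightarrow>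
          (\<exists>c\<in>univ M. \<forall>(\<phi>, as)\<in>\<Sigma>. sat M (c # as) \<phi>)))"

definition elementary_map ::
    "('f, 'r) language \<Rightarrow> ('f, 'r, 'm) struct \<Rightarrow> 'm set \<Rightarrow> ('m \<Rightarrow> 'm) \<Rightarrow> bool" where
  "elementary_map L M A f \<longleftrightarrow> f ` A \<subseteq> univ M \<and>
     (\<forall>as. set as \<subseteq> A \<longrightarrow>
       (\<forall>\<phi>\<in>formulas L (length as). sat M as \<phi> \<longleftrightarrow> sat M (map f as) \<phi>))"

definition automorphism ::
    "('f, 'r) language \<Rightarrow> ('f, 'r, 'm) struct \<Rightarrow> ('m \<Rightarrow> 'm) \<Rightarrow> bool" where
  "automorphism L M g \<longleftrightarrow> bij_betw g (univ M) (univ M) \<and>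
     (\<forall>f\<in>Funs L. \<forall>xs. set xs \<subseteq> univ M \<and> length xs = fun_arity L f
        \<longrightarrow> g (fun_interp M f xs) = fun_interp M f (map g xs)) \<and>
     (\<forall>r\<in>Rels L. \<forall>xs. set xs \<subseteq> univ M \<and> length xs = rel_arity L r
        \<longrightarrow> rel_interp M r xs = rel_interp M r (map g xs))"

definition strongly_homogeneous ::
    "('f, 'r) language \<Rightarrow> 'k rel \<Rightarrow> ('f, 'r, 'm) struct \<Rightarrow> bool" where
  "strongly_homogeneous L \<kappa> M \<longleftrightarrow>
     (\<forall>A \<subseteq> univ M. |A| <o \<kappa> \<longrightarrow>
       (\<forall>f. elementary_map L M A f \<longrightarrow> (\<exists>g. automorphism L M g \<and> (\<forall>a\<in>A. g a = f a))))"

text \<open>A monster model of a theory in a countable language: saturated and strongly homogeneous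
  with respect to some uncountable cardinal \<open>\<kappa>\<close>. No further largeness of \<open>\<kappa>\<close> is required.\<close>

definition monster_model ::
    "('f, 'r) language \<Rightarrow> ('f, 'r) form set \<Rightarrow> 'k rel \<Rightarrow> ('f, 'r, 'm) struct \<Rightarrow> bool" where
  "monster_model L T \<kappa> M \<longleftrightarrow> is_model L T M \<and> Card_order \<kappa> \<and> natLeq <o \<kappa> \<and>
     saturated L \<kappa> M \<and> strongly_homogeneous L \<kappa> M"

text \<open>From here on \<open>M\<close> plays the role of the monster model: consistency with the complete
  theory is finite satisfiability in \<open>M\<close>, and \<open>\<turnstile>\<close> between formulas with parameters from \<open>M\<close>
  is inclusion of their solution sets in \<open>M\<close>.\<close>

definition tp :: "('f, 'r) language \<Rightarrow> ('f, 'r, 'm) struct \<Rightarrow> 'm \<Rightarrow> ('f, 'r) form set" where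
  "tp L M a = {\<phi> \<in> formulas L 1. sat M [a] \<phi>}"

definition complete_1types ::
    "('f, 'r) language \<Rightarrow> ('f, 'r, 'm) struct \<Rightarrow> ('f, 'r) form set set" where
  "complete_1types L M = {p. p \<subseteq> formulas L 1 \<and>
     (\<forall>p\<^sub>0 \<subseteq> p. finite p\<^sub>0 \<longrightarrow> (\<exists>a\<in>univ M. \<forall>\<phi>\<in>p\<^sub>0. sat M [a] \<phi>)) \<and>
     (\<forall>\<phi>\<in>formulas L 1. \<phi> \<in> p \<or> Neg \<phi> \<in> p)}"

definition isolated :: "('f, 'r, 'm) struct \<Rightarrow> ('f, 'r) form set \<Rightarrow> bool" where
  "isolated M p \<longleftrightarrow> (\<exists>\<phi>\<in>p. \<forall>\<psi>\<in>p. \<forall>a\<in>univ M. sat M [a] \<phi> \<longrightarrow> sat M [a] \<psi>)"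

definition realizations :: "('f, 'r, 'm) struct \<Rightarrow> ('f, 'r) form set \<Rightarrow> 'm set" where
  "realizations M p = {a \<in> univ M. \<forall>\<phi>\<in>p. sat M [a] \<phi>}"

definition semi_isolates ::
    "('f, 'r) language \<Rightarrow> ('f, 'r, 'm) struct \<Rightarrow> 'm \<Rightarrow> 'm \<Rightarrow> bool" where
  "semi_isolates L M a b \<longleftrightarrow>
     (\<exists>\<phi>\<in>formulas L 2. sat M [a, b] \<phi> \<and>
        (\<forall>\<psi>\<in>tp L M b. \<forall>c\<in>univ M. sat M [a, c] \<phi> \<longrightarrow> sat M [c] \<psi>))"

definition strictly_semi_isolates ::
    "('f, 'r) language \<Rightarrow> ('f, 'r, 'm) struct \<Rightarrow> 'm \<Rightarrow> 'm \<Rightarrow> bool" where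
  "strictly_semi_isolates L M a b \<longleftrightarrow> semi_isolates L M a b \<and> \<not> semi_isolates L M b a"

definition SI_bar ::
    "('f, 'r) language \<Rightarrow> ('f, 'r, 'm) struct \<Rightarrow> ('f, 'r) form set \<Rightarrow> ('m \<times> 'm) set" where
  "SI_bar L M p = {(a, b). a \<in> realizations M p \<and> b \<in> realizations M p \<and>
     (semi_isolates L M a b \<or> semi_isolates L M b a)}"

definition definable_set ::
    "('f, 'r) language \<Rightarrow> ('f, 'r, 'm) struct \<Rightarrow> 'm list \<Rightarrow> 'm set \<Rightarrow> bool" where
  "definable_set L M e D \<longleftrightarrow>
     (\<exists>\<phi>\<in>formulas L (1 + length e). D = {a \<in> univ M. sat M ([a] @ e) \<phi>})"

definition definable_rel ::
    "('f, 'r) language \<Rightarrow> ('f, 'r, 'm) struct \<Rightarrow> 'm list \<Rightarrow> ('m \<times> 'm) set \<Rightarrow> bool" where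
  "definable_rel L M e R \<longleftrightarrow>
     (\<exists>\<phi>\<in>formulas L (2 + length e).
        R = {(a, b). a \<in> univ M \<and> b \<in> univ M \<and> sat M ([a, b] @ e) \<phi>})"

definition maximal_in :: "'m rel \<Rightarrow> 'm set \<Rightarrow> 'm \<Rightarrow> bool" where
  "maximal_in R D c \<longleftrightarrow> c \<in> D \<and> \<not> (\<exists>d\<in>D. (c, d) \<in> R \<and> (d, c) \<notin> R)"

definition solutions ::
    "('f, 'r, 'm) struct \<Rightarrow> nat \<Rightarrow> ('f, 'r) form \<Rightarrow> 'm list \<Rightarrow> 'm list set" where
  "solutions M n \<phi> b = {xs. length xs = n \<and> set xs \<subseteq> univ M \<and> sat M (xs @ b) \<phi>}"

text \<open>The strict order property of the complete theory of a monster model \<open>M\<close>: some formula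
  \<open>\<phi>(x; y)\<close>, with \<open>x\<close> an \<open>n\<close>-tuple and \<open>y\<close> an \<open>m\<close>-tuple, has an infinite strictly increasing
  chain of instances in \<open>M\<close>.\<close>

definition strict_order_property ::
    "('f, 'r) language \<Rightarrow> ('f, 'r, 'm) struct \<Rightarrow> bool" where
  "strict_order_property L M \<longleftrightarrow>
     (\<exists>n m. \<exists>\<phi>\<in>formulas L (n + m). \<exists>b :: nat \<Rightarrow> 'm list.
        (\<forall>i. length (b i) = m \<and> set (b i) \<subseteq> univ M) \<and>
        (\<forall>i. solutions M n \<phi> (b i) \<subset> solutions M n \<phi> (b (Suc i))))"

end

theory Submission
  imports Defs
begin

text \<open>Write \<open>a \<rightarrow> b\<close> for semi-isolation. It is transitive, and on \<open>p(M)\<close> it is the union of the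
  parameter-free definable relations under which \<open>p(M)\<close> is closed. By compactness one such
  relation \<open>S\<close> satisfies \<open>(a, b) \<in> S\<close> or \<open>(b, a) \<in> S\<close> for all \<open>(a, b) \<in> D\<^sub>1 \<times> D\<^sub>2\<close> in \<open>SI_bar\<close>. Let
  \<open>G\<close> be the intersection of \<open>SI_bar\<close>, \<open>D\<^sub>1 \<times> D\<^sub>2\<close> and \<open>S\<close>; it is definable and, within
  \<open>D\<^sub>1 \<times> D\<^sub>2\<close>, lies between \<open>\<mapsto>\<close> and \<open>\<rightarrow>\<close>. Along \<open>a \<mapsto> b \<rightarrow> a' \<mapsto> b' \<rightarrow> a''\<close> the fiber of \<open>G\<close> strictly
  shrinks from \<open>a\<close> to \<open>a''\<close>, because \<open>a'' \<rightarrow> b\<close> would give \<open>b' \<rightarrow> a'\<close>. Reverse inclusion of the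
  fibers of \<open>G\<close> is the required quasi-order.\<close>

section \<open>Renaming of variables\<close>

lemma in_formulas_iff [simp]:
  "Equal s t \<in> formulas L n \<longleftrightarrow> is_term L n s \<and> is_term L n t"
  "Rel r ts \<in> formulas L n \<longleftrightarrow>
     r \<in> Rels L \<and> length ts = rel_arity L r \<and> (\<forall>t\<in>set ts. is_term L n t)"
  "Neg \<phi> \<in> formulas L n \<longleftrightarrow> \<phi> \<in> formulas L n"
  "Conj \<phi> \<psi> \<in> formulas L n \<longleftrightarrow> \<phi> \<in> formulas L n \<and> \<psi> \<in> formulas L n"
  "Exists \<phi> \<in> formulas L n \<longleftrightarrow> \<phi> \<in> formulas L (Suc n)"
  by (simp_all add: formulas_def)

primrec rename_trm :: "(nat \<Rightarrow> nat) \<Rightarrow> 'f trm \<Rightarrow> 'f trm" where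
  "rename_trm f (Var i) = Var (f i)"
| "rename_trm f (Fn g ts) = Fn g (map (rename_trm f) ts)"

primrec rename :: "(nat \<Rightarrow> nat) \<Rightarrow> ('f, 'r) form \<Rightarrow> ('f, 'r) form" where
  "rename f (Equal s t) = Equal (rename_trm f s) (rename_trm f t)"
| "rename f (Rel r ts) = Rel r (map (rename_trm f) ts)"
| "rename f (Neg \<phi>) = Neg (rename f \<phi>)"
| "rename f (Conj \<phi> \<psi>) = Conj (rename f \<phi>) (rename f \<psi>)"
| "rename f (Exists \<phi>) = Exists (rename (case_nat 0 (\<lambda>i. Suc (f i))) \<phi>)"

lemma is_term_rename_trm:
  "is_term L m t \<Longrightarrow> (\<And>i. i < m \<Longrightarrow> f i < n) \<Longrightarrow> is_term L n (rename_trm f t)"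
  by (induction t) auto

lemma rename_in_formulas:
  "\<phi> \<in> formulas L m \<Longrightarrow> (\<And>i. i < m \<Longrightarrow> f i < n) \<Longrightarrow> rename f \<phi> \<in> formulas L n"
proof (induction \<phi> arbitrary: m n f)
  case (Exists \<phi>)
  then show ?case
    by (auto intro!: Exists.IH[of "Suc m"] split: nat.split)
qed (auto simp: is_term_rename_trm)

lemma eval_rename_trm:
  "is_term L m t \<Longrightarrow> (\<And>i. i < m \<Longrightarrow> xs ! f i = ys ! i) \<Longrightarrow>
    eval M xs (rename_trm f t) = eval M ys t"
proof (induction t)
  case (Fn g ts)
  then have "map (eval M xs \<circ> rename_trm f) ts = map (eval M ys) ts"
    by auto
  then show ?case
    by (simp only: rename_trm.simps eval.simps map_map)
qed auto

lemma sat_rename: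
  "\<phi> \<in> formulas L m \<Longrightarrow> (\<And>i. i < m \<Longrightarrow> xs ! f i = ys ! i) \<Longrightarrow>
    sat M xs (rename f \<phi>) \<longleftrightarrow> sat M ys \<phi>"
proof (induction \<phi> arbitrary: m f xs ys)
  case (Equal s t)
  then show ?case
    using eval_rename_trm[of L m _ xs f ys M] by simp
next
  case (Rel r ts)
  then have "map (eval M xs \<circ> rename_trm f) ts = map (eval M ys) ts"
    using eval_rename_trm[of L m _ xs f ys M] by simp
  then show ?case
    by (simp only: rename.simps sat.simps map_map)
next
  case (Exists \<phi>)
  have "sat M (a # xs) (rename (case_nat 0 (\<lambda>i. Suc (f i))) \<phi>) \<longleftrightarrow> sat M (a # ys) \<phi>" for a
    using Exists.prems by (intro Exists.IH[of "Suc m"]) (auto split: nat.split simp: nth_Cons')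
  then show ?case
    by simp
qed auto

section \<open>Definable sets and relations\<close>

lemma definable_set_iff:
  "definable_set L M e D \<longleftrightarrow>
    (\<exists>\<phi>\<in>formulas L (Suc (length e)). \<forall>a. a \<in> D \<longleftrightarrow> a \<in> univ M \<and> sat M (a # e) \<phi>)"
  by (auto simp: definable_set_def set_eq_iff)

lemma definable_rel_iff:
  "definable_rel L M e R \<longleftrightarrow> (\<exists>\<phi>\<in>formulas L (Suc (Suc (length e))).
    \<forall>a b. (a, b) \<in> R \<longleftrightarrow> a \<in> univ M \<and> b \<in> univ M \<and> sat M (a # b # e) \<phi>)"
  by (auto simp: definable_rel_def set_eq_iff)

lemma definable_set_subset: "definable_set L M e D \<Longrightarrow> D \<subseteq> univ M"
  by (auto simp: definable_set_def)

lemma definable_rel_subset: "definable_rel L M e R \<Longrightarrow> R \<subseteq> univ M \<times> univ M"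
  by (auto simp: definable_rel_def)

lemma definable_set_univ: "definable_set L M e (univ M)"
  unfolding definable_set_iff
  by (intro bexI[of _ "Equal (Var 0) (Var 0)"]) auto

lemma definable_set_Diff:
  assumes "definable_set L M e A" "definable_set L M e B"
  shows "definable_set L M e (A - B)"
proof -
  obtain \<phi> \<psi> where "\<phi> \<in> formulas L (Suc (length e))" "\<psi> \<in> formulas L (Suc (length e))"
    "\<And>a. a \<in> A \<longleftrightarrow> a \<in> univ M \<and> sat M (a # e) \<phi>"
    "\<And>a. a \<in> B \<longleftrightarrow> a \<in> univ M \<and> sat M (a # e) \<psi>"
    using assms by (auto simp: definable_set_iff)
  then show ?thesis
    unfolding definable_set_iff by (intro bexI[of _ "Conj \<phi> (Neg \<psi>)"]) auto
qed

lemma definable_rel_Diff: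
  assumes "definable_rel L M e R" "definable_rel L M e S"
  shows "definable_rel L M e (R - S)"
proof -
  obtain \<phi> \<psi> where "\<phi> \<in> formulas L (Suc (Suc (length e)))" "\<psi> \<in> formulas L (Suc (Suc (length e)))"
    "\<And>a b. (a, b) \<in> R \<longleftrightarrow> a \<in> univ M \<and> b \<in> univ M \<and> sat M (a # b # e) \<phi>"
    "\<And>a b. (a, b) \<in> S \<longleftrightarrow> a \<in> univ M \<and> b \<in> univ M \<and> sat M (a # b # e) \<psi>"
    using assms by (auto simp: definable_rel_iff)
  then show ?thesis
    unfolding definable_rel_iff by (intro bexI[of _ "Conj \<phi> (Neg \<psi>)"]) auto
qed

lemma definable_rel_Times:
  assumes "definable_set L M e A" "definable_set L M e B"
  shows "definable_rel L M e (A \<times> B)"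
proof -
  obtain \<phi> \<psi> where \<phi>: "\<phi> \<in> formulas L (Suc (length e))"
      "\<And>a. a \<in> A \<longleftrightarrow> a \<in> univ M \<and> sat M (a # e) \<phi>"
    and \<psi>: "\<psi> \<in> formulas L (Suc (length e))"
      "\<And>b. b \<in> B \<longleftrightarrow> b \<in> univ M \<and> sat M (b # e) \<psi>"
    using assms by (auto simp: definable_set_iff)
  have "sat M (a # b # e) (rename (Suc(0 := 0)) \<phi>) \<longleftrightarrow> sat M (a # e) \<phi>" for a b
    by (rule sat_rename[OF \<phi>(1)]) (simp add: nth_Cons')
  moreover have "sat M (a # b # e) (rename Suc \<psi>) \<longleftrightarrow> sat M (b # e) \<psi>" for a b
    by (rule sat_rename[OF \<psi>(1)]) simp
  ultimately show ?thesis
    unfolding definable_rel_iff using \<phi> \<psi>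
    by (intro bexI[of _ "Conj (rename (Suc(0 := 0)) \<phi>) (rename Suc \<psi>)"])
      (auto intro: rename_in_formulas)
qed

lemma definable_rel_Int:
  assumes "definable_rel L M e R" "definable_rel L M e S"
  shows "definable_rel L M e (R \<inter> S)"
  unfolding Diff_Diff_Int[symmetric] by (intro definable_rel_Diff assms)

lemma definable_rel_Un:
  assumes "definable_rel L M e R" "definable_rel L M e S"
  shows "definable_rel L M e (R \<union> S)"
proof -
  let ?V = "univ M \<times> univ M"
  have "R \<union> S = ?V - (?V - R - S)"
    using assms[THEN definable_rel_subset] by blast
  then show ?thesis
    using assms by (simp add: definable_rel_Diff definable_rel_Times definable_set_univ)
qed

lemma definable_rel_empty: "definable_rel L M e {}"
proof -
  have "definable_rel L M e (univ M \<times> univ M - univ M \<times> univ M)"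
    by (intro definable_rel_Diff definable_rel_Times definable_set_univ)
  then show ?thesis
    by simp
qed

lemma definable_rel_Union:
  assumes "finite \<R>" "\<And>R. R \<in> \<R> \<Longrightarrow> definable_rel L M e R"
  shows "definable_rel L M e (\<Union>\<R>)"
  using assms by (induction \<R>) (simp_all add: definable_rel_empty definable_rel_Un)

lemma definable_rel_converse:
  assumes "definable_rel L M e R"
  shows "definable_rel L M e (R\<inverse>)"
proof -
  obtain \<phi> where \<phi>: "\<phi> \<in> formulas L (Suc (Suc (length e)))"
    "\<And>a b. (a, b) \<in> R \<longleftrightarrow> a \<in> univ M \<and> b \<in> univ M \<and> sat M (a # b # e) \<phi>"
    using assms by (auto simp: definable_rel_iff)
  have "sat M (b # a # e) (rename (id(0 := 1, 1 := 0)) \<phi>) \<longleftrightarrow> sat M (a # b # e) \<phi>" for a b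
    by (rule sat_rename[OF \<phi>(1)]) (simp add: nth_Cons')
  then show ?thesis
    unfolding definable_rel_iff using \<phi>
    by (intro bexI[of _ "rename (id(0 := 1, 1 := 0)) \<phi>"]) (auto intro: rename_in_formulas)
qed

lemma definable_rel_relcomp:
  assumes "definable_rel L M e R" "definable_rel L M e S"
  shows "definable_rel L M e (R O S)"
proof -
  obtain \<phi> \<psi> where \<phi>: "\<phi> \<in> formulas L (Suc (Suc (length e)))"
      "\<And>a b. (a, b) \<in> R \<longleftrightarrow> a \<in> univ M \<and> b \<in> univ M \<and> sat M (a # b # e) \<phi>"
    and \<psi>: "\<psi> \<in> formulas L (Suc (Suc (length e)))"
      "\<And>a b. (a, b) \<in> S \<longleftrightarrow> a \<in> univ M \<and> b \<in> univ M \<and> sat M (a # b # e) \<psi>"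
    using assms by (auto simp: definable_rel_iff)
  have "sat M (c # a # b # e) (rename (Suc(1 := 0)) \<phi>) \<longleftrightarrow> sat M (a # c # e) \<phi>" for a b c
    by (rule sat_rename[OF \<phi>(1)]) (simp add: nth_Cons')
  moreover have "sat M (c # a # b # e) (rename (Suc(0 := 0)) \<psi>) \<longleftrightarrow> sat M (c # b # e) \<psi>" for a b c
    by (rule sat_rename[OF \<psi>(1)]) (simp add: nth_Cons')
  ultimately show ?thesis
    unfolding definable_rel_iff using \<phi> \<psi>
    by (intro bexI[of _ "Exists (Conj (rename (Suc(1 := 0)) \<phi>) (rename (Suc(0 := 0)) \<psi>))"])
      (auto intro: rename_in_formulas)
qed

lemma definable_set_Domain:
  assumes "definable_rel L M e R"
  shows "definable_set L M e (Domain R)"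
proof -
  obtain \<phi> where "\<phi> \<in> formulas L (Suc (Suc (length e)))"
    "\<And>a b. (b, a) \<in> R\<inverse> \<longleftrightarrow> b \<in> univ M \<and> a \<in> univ M \<and> sat M (b # a # e) \<phi>"
    using definable_rel_converse[OF assms] unfolding definable_rel_iff by blast
  then show ?thesis
    unfolding definable_set_iff by (intro bexI[of _ "Exists \<phi>"]) auto
qed

lemma definable_set_Image_singleton:
  assumes "definable_rel L M e R" "a \<in> univ M"
  shows "definable_set L M (a # e) (R `` {a})"
proof -
  obtain \<phi> where "\<phi> \<in> formulas L (Suc (Suc (length e)))"
    "\<And>a b. (b, a) \<in> R\<inverse> \<longleftrightarrow> b \<in> univ M \<and> a \<in> univ M \<and> sat M (b # a # e) \<phi>"
    using definable_rel_converse[OF assms(1)] unfolding definable_rel_iff by blast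
  then show ?thesis
    unfolding definable_set_iff using assms(2) by (intro bexI[of _ \<phi>]) auto
qed

lemma definable_rel_mono_params:
  assumes "definable_rel L M d R" "set d \<subseteq> set e"
  shows "definable_rel L M e R"
proof -
  obtain \<phi> where \<phi>: "\<phi> \<in> formulas L (Suc (Suc (length d)))"
    "\<And>a b. (a, b) \<in> R \<longleftrightarrow> a \<in> univ M \<and> b \<in> univ M \<and> sat M (a # b # d) \<phi>"
    using assms(1) by (auto simp: definable_rel_iff)
  have "\<forall>i<length d. \<exists>j<length e. e ! j = d ! i"
    using assms(2) by (metis in_set_conv_nth nth_mem subsetD)
  then obtain g where g: "\<And>i. i < length d \<Longrightarrow> g i < length e \<and> e ! g i = d ! i"
    by metis
  define f where "f = case_nat 0 (case_nat 1 (\<lambda>i. Suc (Suc (g i))))"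
  have "sat M (a # b # e) (rename f \<phi>) \<longleftrightarrow> sat M (a # b # d) \<phi>" for a b
    by (rule sat_rename[OF \<phi>(1)]) (auto simp: f_def g split: nat.split)
  moreover have "rename f \<phi> \<in> formulas L (Suc (Suc (length e)))"
    by (rule rename_in_formulas[OF \<phi>(1)]) (auto simp: f_def g split: nat.split)
  ultimately show ?thesis
    unfolding definable_rel_iff using \<phi>(2) by blast
qed

section \<open>Compactness\<close>

lemma saturated_Inter_definable_sets:
  assumes "saturated L \<kappa> M" "natLeq \<le>o \<kappa>" "set e \<subseteq> univ M"
    and definable: "\<And>D. D \<in> \<D> \<Longrightarrow> definable_set L M e D"
    and fip: "\<And>\<F>. finite \<F> \<Longrightarrow> \<F> \<subseteq> \<D> \<Longrightarrow> univ M \<inter> \<Inter>\<F> \<noteq> {}"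
  shows "univ M \<inter> \<Inter>\<D> \<noteq> {}"
proof -
  define sols where "sols = (\<lambda>(\<phi>, as). {c \<in> univ M. sat M (c # as) \<phi>})"
  define \<Sigma> where "\<Sigma> = {(\<phi>, e) |\<phi>. \<phi> \<in> formulas L (Suc (length e)) \<and> sols (\<phi>, e) \<in> \<D>}"
  have "\<exists>c\<in>univ M. \<forall>(\<phi>, as)\<in>\<Sigma>\<^sub>0. sat M (c # as) \<phi>" if "\<Sigma>\<^sub>0 \<subseteq> \<Sigma>" "finite \<Sigma>\<^sub>0" for \<Sigma>\<^sub>0
  proof -
    have "univ M \<inter> \<Inter>(sols ` \<Sigma>\<^sub>0) \<noteq> {}"
      using that by (intro fip) (auto simp: \<Sigma>_def)
    then show ?thesis
      by (fastforce simp: sols_def)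
  qed
  moreover have "|set e| <o \<kappa>"
    using assms(2) finite_iff_ordLess_natLeq ordLess_ordLeq_trans by blast
  moreover have "\<Sigma> \<subseteq> param_formulas L (set e)"
    by (auto simp: param_formulas_def \<Sigma>_def)
  ultimately have "\<exists>c\<in>univ M. \<forall>(\<phi>, as)\<in>\<Sigma>. sat M (c # as) \<phi>"
    using assms(1,3) unfolding saturated_def by metis
  then obtain c where c: "c \<in> univ M" "\<forall>(\<phi>, as)\<in>\<Sigma>. sat M (c # as) \<phi>" ..
  have "c \<in> D" if D: "D \<in> \<D>" for D
  proof -
    obtain \<phi> where "\<phi> \<in> formulas L (Suc (length e))" "D = sols (\<phi>, e)"
      using definable[OF D] by (auto simp: definable_set_def sols_def)
    then show ?thesis
      using c D by (auto simp: \<Sigma>_def sols_def)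
  qed
  then show ?thesis
    using c(1) by blast
qed

lemma definable_set_finite_subcover:
  assumes "saturated L \<kappa> M" "natLeq \<le>o \<kappa>" "set e \<subseteq> univ M"
    and X: "definable_set L M e X"
    and \<U>: "\<And>U. U \<in> \<U> \<Longrightarrow> definable_set L M e U" "X \<subseteq> \<Union>\<U>"
  shows "\<exists>\<V>. finite \<V> \<and> \<V> \<subseteq> \<U> \<and> X \<subseteq> \<Union>\<V>"
proof (rule ccontr)
  assume "\<not> ?thesis"
  then have no_subcover: "X - \<Union>\<V> \<noteq> {}" if "finite \<V>" "\<V> \<subseteq> \<U>" for \<V>
    using that by blast
  have "univ M \<inter> \<Inter>((\<lambda>U. X - U) ` \<U>) \<noteq> {}"
  proof (rule saturated_Inter_definable_sets[OF assms(1-3)])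
    fix \<F> assume "finite \<F>" "\<F> \<subseteq> (\<lambda>U. X - U) ` \<U>"
    then obtain \<V> where \<V>: "finite \<V>" "\<V> \<subseteq> \<U>" "\<F> = (\<lambda>U. X - U) ` \<V>"
      by (metis finite_subset_image)
    have "X - \<Union>\<V> \<subseteq> univ M \<inter> \<Inter>\<F>"
      using definable_set_subset[OF X] \<V>(3) by blast
    then show "univ M \<inter> \<Inter>\<F> \<noteq> {}"
      using no_subcover[OF \<V>(1,2)] by blast
  qed (use X \<U>(1) definable_set_Diff in blast)
  then obtain c where "\<And>U. U \<in> \<U> \<Longrightarrow> c \<in> X - U"
    by blast
  moreover have "X \<noteq> {}"
    using no_subcover[of "{}"] by simp
  ultimately show False
    using \<U>(2) by blast
qed

text \<open>Saturation only speaks of 1-types, so this is proved fiberwise, as for a product of two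
  compact spaces.\<close>

lemma definable_rel_finite_subcover:
  assumes saturated: "saturated L \<kappa> M" "natLeq \<le>o \<kappa>" and e: "set e \<subseteq> univ M"
    and X: "definable_rel L M e X"
    and \<U>: "\<And>U. U \<in> \<U> \<Longrightarrow> definable_rel L M e U" "X \<subseteq> \<Union>\<U>"
  shows "\<exists>\<V>. finite \<V> \<and> \<V> \<subseteq> \<U> \<and> X \<subseteq> \<Union>\<V>"
proof -
  define tube where "tube \<V> = univ M - Domain (X - \<Union>\<V>)" for \<V>
  have fiber: "\<exists>\<V>. finite \<V> \<and> \<V> \<subseteq> \<U> \<and> a \<in> tube \<V>" if a: "a \<in> univ M" for a
  proof -
    have "X `` {a} \<subseteq> \<Union>((\<lambda>U. U `` {a}) ` \<U>)"
      using \<U>(2) by blast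
    moreover have "definable_set L M (a # e) (X `` {a})"
      using X a by (rule definable_set_Image_singleton)
    moreover have "definable_set L M (a # e) U" if "U \<in> (\<lambda>U. U `` {a}) ` \<U>" for U
      using that by (auto intro: definable_set_Image_singleton[OF \<U>(1) a])
    ultimately have "\<exists>\<W>. finite \<W> \<and> \<W> \<subseteq> (\<lambda>U. U `` {a}) ` \<U> \<and> X `` {a} \<subseteq> \<Union>\<W>"
      using a e by (intro definable_set_finite_subcover[OF saturated]) auto
    then obtain \<V> where "finite \<V>" "\<V> \<subseteq> \<U>" "X `` {a} \<subseteq> \<Union>((\<lambda>U. U `` {a}) ` \<V>)"
      unfolding ex_finite_subset_image by blast
    then show ?thesis
      using a by (intro exI[of _ \<V>]) (auto simp: tube_def)
  qed
  let ?\<T> = "tube ` {\<V>. finite \<V> \<and> \<V> \<subseteq> \<U>}"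
  have "definable_set L M e (tube \<V>)" if "finite \<V>" "\<V> \<subseteq> \<U>" for \<V>
    unfolding tube_def using that \<U>(1)
    by (intro definable_set_Diff definable_set_univ definable_set_Domain definable_rel_Diff
        definable_rel_Union X) auto
  then have "\<And>D. D \<in> ?\<T> \<Longrightarrow> definable_set L M e D"
    by auto
  moreover have "univ M \<subseteq> \<Union>?\<T>"
    using fiber by fast
  ultimately have "\<exists>\<T>. finite \<T> \<and> \<T> \<subseteq> ?\<T> \<and> univ M \<subseteq> \<Union>\<T>"
    by (rule definable_set_finite_subcover[OF saturated e definable_set_univ])
  then obtain \<C> where \<C>: "finite \<C>" "\<C> \<subseteq> {\<V>. finite \<V> \<and> \<V> \<subseteq> \<U>}" "univ M \<subseteq> \<Union>(tube ` \<C>)"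
    unfolding ex_finite_subset_image by blast
  show ?thesis
  proof (intro exI conjI)
    show "finite (\<Union>\<C>)" "\<Union>\<C> \<subseteq> \<U>"
      using \<C>(1,2) by auto
    show "X \<subseteq> \<Union>(\<Union>\<C>)"
      using \<C>(3) definable_rel_subset[OF X] by (fastforce simp: tube_def)
  qed
qed

section \<open>Semi-isolation\<close>

lemma realizations_tp_subset_definable_set:
  assumes "definable_set L M [] D" "a \<in> D"
  shows "realizations M (tp L M a) \<subseteq> D"
proof -
  obtain \<phi> where "\<phi> \<in> formulas L 1" "\<And>c. c \<in> D \<longleftrightarrow> c \<in> univ M \<and> sat M [c] \<phi>"
    using assms(1) by (auto simp: definable_set_iff)
  with assms(2) show ?thesis
    by (auto simp: realizations_def tp_def)
qed

lemma tp_realization: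
  assumes "p \<in> complete_1types L M" "a \<in> realizations M p"
  shows "tp L M a = p"
proof
  show "p \<subseteq> tp L M a"
    using assms by (auto simp: complete_1types_def realizations_def tp_def)
  show "tp L M a \<subseteq> p"
  proof
    fix \<phi> assume \<phi>: "\<phi> \<in> tp L M a"
    then have "\<phi> \<in> p \<or> Neg \<phi> \<in> p"
      using assms(1) by (simp add: complete_1types_def tp_def)
    moreover have "\<not> sat M [a] (Neg \<phi>)"
      using \<phi> by (simp add: tp_def)
    ultimately show "\<phi> \<in> p"
      using assms(2) unfolding realizations_def by blast
  qed
qed

definition semi_isolating_rel ::
    "('f, 'r) language \<Rightarrow> ('f, 'r, 'm) struct \<Rightarrow> ('f, 'r) form set \<Rightarrow> ('f, 'r) form set \<Rightarrow>
      ('m \<times> 'm) set \<Rightarrow> bool" where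
  "semi_isolating_rel L M p q S \<longleftrightarrow>
     definable_rel L M [] S \<and> S `` realizations M p \<subseteq> realizations M q"

lemma semi_isolating_rel_Union:
  assumes "finite \<S>" "\<And>S. S \<in> \<S> \<Longrightarrow> semi_isolating_rel L M p q S"
  shows "semi_isolating_rel L M p q (\<Union>\<S>)"
  using assms definable_rel_Union[of \<S> L M "[]"] unfolding semi_isolating_rel_def by blast

lemma semi_isolating_rel_relcomp:
  assumes "semi_isolating_rel L M p q R" "semi_isolating_rel L M q r S"
  shows "semi_isolating_rel L M p r (R O S)"
  using assms definable_rel_relcomp[of L M "[]" R S] unfolding semi_isolating_rel_def by blast

lemma semi_isolating_rel_tpI:
  assumes S: "definable_rel L M [] S" and a: "a \<in> univ M" "S `` {a} \<subseteq> realizations M (tp L M b)"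
  shows "semi_isolating_rel L M (tp L M a) (tp L M b) S"
proof -
  have "sat M [d] \<psi>" if "c \<in> realizations M (tp L M a)" "(c, d) \<in> S" "\<psi> \<in> tp L M b" for c d \<psi>
  proof -
    let ?\<psi> = "{x \<in> univ M. sat M [x] \<psi>}"
    let ?D = "univ M - Domain (S - univ M \<times> ?\<psi>)"
    have "definable_set L M [] ?\<psi>"
      using \<open>\<psi> \<in> tp L M b\<close> by (auto simp: definable_set_def tp_def)
    then have "definable_set L M [] ?D"
      by (intro definable_set_Diff definable_set_Domain definable_rel_Diff definable_rel_Times
          definable_set_univ S)
    moreover have "a \<in> ?D"
      using a \<open>\<psi> \<in> tp L M b\<close> by (auto simp: realizations_def)
    ultimately have "c \<in> ?D"
      by (rule subsetD[OF realizations_tp_subset_definable_set that(1)])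
    then show ?thesis
      using that(2) by blast
  qed
  then show ?thesis
    using S definable_rel_subset[OF S] by (auto simp: semi_isolating_rel_def realizations_def)
qed

lemma semi_isolates_iff_semi_isolating_rel:
  assumes "a \<in> univ M" "b \<in> univ M"
  shows "semi_isolates L M a b \<longleftrightarrow>
    (\<exists>S. semi_isolating_rel L M (tp L M a) (tp L M b) S \<and> (a, b) \<in> S)"
proof
  assume "semi_isolates L M a b"
  then obtain \<phi> where \<phi>: "\<phi> \<in> formulas L 2" "sat M [a, b] \<phi>"
    "\<And>\<psi> c. \<psi> \<in> tp L M b \<Longrightarrow> c \<in> univ M \<Longrightarrow> sat M [a, c] \<phi> \<Longrightarrow> sat M [c] \<psi>"
    unfolding semi_isolates_def by blast
  define S where "S = {(c, d). c \<in> univ M \<and> d \<in> univ M \<and> sat M [c, d] \<phi>}"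
  have "definable_rel L M [] S" "S `` {a} \<subseteq> realizations M (tp L M b)"
    using \<phi>(1,3) by (auto simp: definable_rel_def S_def realizations_def)
  then have "semi_isolating_rel L M (tp L M a) (tp L M b) S"
    by (intro semi_isolating_rel_tpI assms(1))
  moreover have "(a, b) \<in> S"
    using assms \<phi>(2) by (simp add: S_def)
  ultimately show "\<exists>S. semi_isolating_rel L M (tp L M a) (tp L M b) S \<and> (a, b) \<in> S"
    by blast
next
  assume "\<exists>S. semi_isolating_rel L M (tp L M a) (tp L M b) S \<and> (a, b) \<in> S"
  then obtain S \<phi> where "\<phi> \<in> formulas L 2"
    and S: "S = {(c, d). c \<in> univ M \<and> d \<in> univ M \<and> sat M [c, d] \<phi>}" "(a, b) \<in> S"
    and closed: "S `` realizations M (tp L M a) \<subseteq> realizations M (tp L M b)"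
    by (auto simp: semi_isolating_rel_def definable_rel_def)
  moreover have "a \<in> realizations M (tp L M a)"
    using assms(1) by (simp add: realizations_def tp_def)
  then have "c \<in> realizations M (tp L M b)" if "c \<in> univ M" "sat M [a, c] \<phi>" for c
    using that closed assms(1) by (auto simp: S(1))
  ultimately show "semi_isolates L M a b"
    unfolding semi_isolates_def realizations_def by blast
qed

lemma semi_isolates_trans:
  assumes "a \<in> univ M" "b \<in> univ M" "c \<in> univ M"
    and "semi_isolates L M a b" "semi_isolates L M b c"
  shows "semi_isolates L M a c"
proof -
  obtain R S where
    "semi_isolating_rel L M (tp L M a) (tp L M b) R" "(a, b) \<in> R"
    "semi_isolating_rel L M (tp L M b) (tp L M c) S" "(b, c) \<in> S"
    using assms by (auto simp: semi_isolates_iff_semi_isolating_rel)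
  then have "semi_isolating_rel L M (tp L M a) (tp L M c) (R O S)" "(a, c) \<in> R O S"
    using semi_isolating_rel_relcomp by auto
  then show ?thesis
    using assms(1,3) by (auto simp: semi_isolates_iff_semi_isolating_rel)
qed

definition SI ::
    "('f, 'r) language \<Rightarrow> ('f, 'r, 'm) struct \<Rightarrow> ('f, 'r) form set \<Rightarrow> ('m \<times> 'm) set" where
  "SI L M p = {(a, b). a \<in> realizations M p \<and> b \<in> realizations M p \<and> semi_isolates L M a b}"

lemma SI_bar_eq: "SI_bar L M p = SI L M p \<union> (SI L M p)\<inverse>"
  by (auto simp: SI_bar_def SI_def)

lemma trans_SI: "trans (SI L M p)"
  by (rule transI) (auto simp: SI_def realizations_def intro: semi_isolates_trans)

lemma SI_eq_Union_semi_isolating_rels: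
  assumes "p \<in> complete_1types L M"
  shows "SI L M p = Restr (\<Union>(Collect (semi_isolating_rel L M p p))) (realizations M p)"
proof -
  have "semi_isolates L M a b \<longleftrightarrow> (\<exists>S. semi_isolating_rel L M p p S \<and> (a, b) \<in> S)"
    if "a \<in> realizations M p" "b \<in> realizations M p" for a b
    using that semi_isolates_iff_semi_isolating_rel[of a M b L] tp_realization[OF assms]
    by (simp add: realizations_def)
  then show ?thesis
    by (auto simp: SI_def)
qed

lemma semi_isolating_rel_covers_SI_bar:
  assumes saturated: "saturated L \<kappa> M" "natLeq \<le>o \<kappa>" and p: "p \<in> complete_1types L M"
    and e: "set e \<subseteq> univ M" and X: "definable_rel L M e X" "X \<subseteq> SI_bar L M p"
  obtains S where "semi_isolating_rel L M p p S" "X \<subseteq> S \<union> S\<inverse>"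
proof -
  let ?sym = "\<lambda>S. S \<union> S\<inverse>"
  let ?\<S> = "Collect (semi_isolating_rel L M p p)"
  have "X \<subseteq> \<Union>(?sym ` ?\<S>)"
    using X(2) by (auto simp: SI_bar_eq SI_eq_Union_semi_isolating_rels[OF p])
  moreover have "definable_rel L M e U" if U: "U \<in> ?sym ` ?\<S>" for U
  proof -
    obtain S where S: "definable_rel L M [] S" "U = ?sym S"
      using U by (auto simp: semi_isolating_rel_def)
    have "definable_rel L M e S"
      by (rule definable_rel_mono_params[OF S(1)]) simp
    then show ?thesis
      unfolding S(2) by (intro definable_rel_Un definable_rel_converse)
  qed
  ultimately have "\<exists>\<V>. finite \<V> \<and> \<V> \<subseteq> ?sym ` ?\<S> \<and> X \<subseteq> \<Union>\<V>"
    by (intro definable_rel_finite_subcover[OF saturated e X(1)])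
  then obtain \<T> where \<T>: "finite \<T>" "\<T> \<subseteq> ?\<S>" "X \<subseteq> \<Union>(?sym ` \<T>)"
    unfolding ex_finite_subset_image by blast
  show thesis
  proof
    show "semi_isolating_rel L M p p (\<Union>\<T>)"
      using \<T>(1,2) by (blast intro: semi_isolating_rel_Union)
    show "X \<subseteq> \<Union>\<T> \<union> (\<Union>\<T>)\<inverse>"
      using \<T>(3) by auto
  qed
qed

lemma definable_rel_between_strict_SI_and_SI:
  assumes "saturated L \<kappa> M" "natLeq \<le>o \<kappa>" "p \<in> complete_1types L M" "set e \<subseteq> univ M"
    and X: "definable_rel L M e (SI_bar L M p \<inter> X)"
  obtains G where "definable_rel L M e G" "(SI L M p - (SI L M p)\<inverse>) \<inter> X \<subseteq> G" "G \<subseteq> SI L M p \<inter> X"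
proof -
  obtain S where S: "semi_isolating_rel L M p p S" "SI_bar L M p \<inter> X \<subseteq> S \<union> S\<inverse>"
    using semi_isolating_rel_covers_SI_bar[OF assms] by blast
  have Restr_S: "Restr S (realizations M p) \<subseteq> SI L M p"
    using S(1) by (auto simp: SI_eq_Union_semi_isolating_rels[OF assms(3)])
  have SI_bar_subset: "SI_bar L M p \<subseteq> realizations M p \<times> realizations M p"
    by (auto simp: SI_bar_def)
  have "definable_rel L M [] S"
    using S(1) by (simp add: semi_isolating_rel_def)
  then have "definable_rel L M e S"
    by (rule definable_rel_mono_params) simp
  show thesis
  proof
    show "definable_rel L M e (SI_bar L M p \<inter> X \<inter> S)"
      using X \<open>definable_rel L M e S\<close> by (rule definable_rel_Int)
    show "SI_bar L M p \<inter> X \<inter> S \<subseteq> SI L M p \<inter> X"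
      using SI_bar_subset Restr_S by blast
    have "(a, b) \<in> S" if "(a, b) \<in> SI L M p - (SI L M p)\<inverse>" "(a, b) \<in> X" for a b
    proof -
      have ab: "(a, b) \<in> SI_bar L M p \<inter> X"
        using that by (auto simp: SI_bar_eq)
      moreover have "(b, a) \<notin> S"
        using that(1) ab SI_bar_subset Restr_S by blast
      ultimately show ?thesis
        using S(2) by blast
    qed
    then show "(SI L M p - (SI L M p)\<inverse>) \<inter> X \<subseteq> SI_bar L M p \<inter> X \<inter> S"
      by (auto simp: SI_bar_eq)
  qed
qed

section \<open>Descending fibers\<close>

lemma ex_Image_psubset_if_alternating:
  fixes Q G :: "'a rel"
  assumes Q: "trans Q"
    and G: "(Q - Q\<inverse>) \<inter> A \<times> B \<subseteq> G" "G \<subseteq> Q \<inter> A \<times> B"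
    and ascend: "\<And>a. a \<in> A \<Longrightarrow> \<exists>b\<in>B. (a, b) \<in> Q - Q\<inverse>"
    and return: "\<And>b. b \<in> B \<Longrightarrow> \<exists>a\<in>A. (b, a) \<in> Q"
    and a: "a \<in> A"
  shows "\<exists>a'\<in>A. G `` {a'} \<subset> G `` {a}"
proof -
  obtain b where b: "b \<in> B" "(a, b) \<in> Q - Q\<inverse>"
    using ascend[OF a] by blast
  obtain a' where a': "a' \<in> A" "(b, a') \<in> Q"
    using return[OF b(1)] by blast
  obtain b' where b': "b' \<in> B" "(a', b') \<in> Q - Q\<inverse>"
    using ascend[OF a'(1)] by blast
  obtain a'' where a'': "a'' \<in> A" "(b', a'') \<in> Q"
    using return[OF b'(1)] by blast
  have a''_b: "(a'', b) \<notin> Q"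
    using a'(2) a''(2) b'(2) transD[OF Q] by blast
  have "(a, a'') \<in> Q"
    using b(2) a'(2) b'(2) a''(2) transD[OF Q] by blast
  have "G `` {a''} \<subseteq> G `` {a}"
  proof
    fix c assume "c \<in> G `` {a''}"
    then have c: "(a'', c) \<in> Q" "c \<in> B"
      using G(2) by auto
    have "(a, c) \<in> Q"
      using \<open>(a, a'') \<in> Q\<close> c(1) transD[OF Q] by blast
    moreover have "(c, a) \<notin> Q"
      using c(1) b(2) a''_b transD[OF Q] by blast
    ultimately show "c \<in> G `` {a}"
      using G(1) a c(2) by blast
  qed
  moreover have "b \<in> G `` {a}" "b \<notin> G `` {a''}"
    using G a b a''_b by blast+
  ultimately show "\<exists>a'\<in>A. G `` {a'} \<subset> G `` {a}"
    using a''(1) by blast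
qed

text \<open>The clause on \<open>Domain G\<close> keeps points with empty fiber from lying above \<open>Domain G\<close>.\<close>

definition reverse_Image_order :: "'a set \<Rightarrow> 'a rel \<Rightarrow> 'a rel" where
  "reverse_Image_order A G =
     {(x, y) \<in> A \<times> A. G `` {y} \<subseteq> G `` {x} \<and> (x \<in> Domain G \<longrightarrow> y \<in> Domain G)}"

lemma preorder_on_reverse_Image_order: "preorder_on A (reverse_Image_order A G)"
  unfolding preorder_on_def reverse_Image_order_def by (auto intro!: refl_onI transI)

lemma not_maximal_in_reverse_Image_order:
  assumes "\<And>x. x \<in> Domain G \<Longrightarrow> \<exists>y\<in>Domain G. G `` {y} \<subset> G `` {x}"
    and "Domain G \<subseteq> A" "Domain G \<subseteq> D"
    and "x \<in> Domain G" "(x, c) \<in> reverse_Image_order A G"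
  shows "\<not> maximal_in (reverse_Image_order A G) D c"
proof -
  have c: "c \<in> Domain G"
    using assms(4,5) by (simp add: reverse_Image_order_def)
  then obtain d where "d \<in> Domain G" "G `` {d} \<subset> G `` {c}"
    using assms(1) by blast
  then have "d \<in> D" "(c, d) \<in> reverse_Image_order A G" "(d, c) \<notin> reverse_Image_order A G"
    using c assms(2,3) unfolding reverse_Image_order_def by auto
  then show ?thesis
    by (auto simp: maximal_in_def)
qed

lemma definable_rel_reverse_Image_order:
  assumes G: "definable_rel L M e G"
  shows "definable_rel L M e (reverse_Image_order (univ M) G)"
proof -
  let ?V = "univ M \<times> univ M"
  have "reverse_Image_order (univ M) G =
      ?V - (?V - G) O G\<inverse> - Domain G \<times> (univ M - Domain G)"
    using definable_rel_subset[OF G] unfolding reverse_Image_order_def by auto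
  also have "definable_rel L M e \<dots>"
    by (intro definable_rel_Diff definable_rel_Times definable_rel_relcomp definable_rel_converse
        definable_set_Diff definable_set_Domain definable_set_univ G)
  finally show ?thesis .
qed

lemma strict_order_property_if_decreasing_Images:
  assumes G: "definable_rel L M e G" and e: "set e \<subseteq> univ M"
    and a: "\<And>i. a i \<in> univ M" "\<And>i :: nat. G `` {a (Suc i)} \<subset> G `` {a i}"
  shows "strict_order_property L M"
proof -
  have "definable_rel L M e ((univ M \<times> univ M - G)\<inverse>)"
    by (intro definable_rel_converse definable_rel_Diff definable_rel_Times definable_set_univ G)
  then obtain \<phi> where \<phi>: "\<phi> \<in> formulas L (1 + Suc (length e))"
    "\<And>x y. (x, y) \<in> (univ M \<times> univ M - G)\<inverse> \<longleftrightarrow> x \<in> univ M \<and> y \<in> univ M \<and> sat M (x # y # e) \<phi>"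
    by (auto simp: definable_rel_iff)
  have "sat M (x # a i # e) \<phi> \<longleftrightarrow> (a i, x) \<notin> G" if "x \<in> univ M" for x i
    using \<phi>(2)[of x "a i"] that a(1) by auto
  then have sol: "solutions M 1 \<phi> (a i # e) = (\<lambda>x. [x]) ` (univ M - G `` {a i})" for i
    by (auto simp: solutions_def length_Suc_conv)
  have "univ M - G `` {a i} \<subset> univ M - G `` {a (Suc i)}" for i
    using a(2)[of i] definable_rel_subset[OF G] by blast
  then have "solutions M 1 \<phi> (a i # e) \<subset> solutions M 1 \<phi> (a (Suc i) # e)" for i
    unfolding sol by (simp add: image_strict_mono inj_on_def)
  with \<phi>(1) e a(1) show ?thesis
    unfolding strict_order_property_def
    by (intro exI[of _ 1] exI[of _ "Suc (length e)"] bexI[of _ \<phi>] exI[of _ "\<lambda>i. a i # e"]) auto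
qed

lemma strict_order_property_if_no_minimal_Image:
  assumes "definable_rel L M e G" "set e \<subseteq> univ M" "A \<subseteq> univ M" "A \<noteq> {}"
    and "\<And>x. x \<in> A \<Longrightarrow> \<exists>y\<in>A. G `` {y} \<subset> G `` {x}"
  shows "strict_order_property L M"
proof -
  obtain a where "\<And>i :: nat. a i \<in> A \<and> G `` {a (Suc i)} \<subset> G `` {a i}"
    using dependent_nat_choice[of "\<lambda>_ x. x \<in> A" "\<lambda>_ x y. G `` {y} \<subset> G `` {x}"] assms(4,5)
    by (metis ex_in_conv)
  then show ?thesis
    using strict_order_property_if_decreasing_Images[OF assms(1,2), of a] assms(3) by blast
qed

theorem theorem3p1:
  fixes L :: "('f, 'r) language"
    and T :: "('f, 'r) form set"
    and \<kappa> :: "'k rel"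
    and M :: "('f, 'r, 'm) struct"
    and p :: "('f, 'r) form set"
    and e :: "'m list"
    and D\<^sub>1 D\<^sub>2 :: "'m set"
  assumes "countable_language L"
    and "complete_theory L T"
    and "monster_model L T \<kappa> M"
    and "p \<in> complete_1types L M"
    and "\<not> isolated M p"
    and "set e \<subseteq> univ M"
    and "definable_set L M e D\<^sub>1"
    and "definable_set L M e D\<^sub>2"
    and "SI_bar L M p \<inter> (D\<^sub>1 \<times> D\<^sub>2) \<noteq> {}"
    and "\<exists>E. definable_rel L M e E \<and> SI_bar L M p \<inter> (D\<^sub>1 \<times> D\<^sub>2) = E \<inter> (D\<^sub>1 \<times> D\<^sub>2)"
    and "\<forall>a \<in> D\<^sub>1 \<inter> realizations M p. \<exists>b \<in> D\<^sub>2 \<inter> realizations M p. strictly_semi_isolates L M a b"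
    and "\<forall>b \<in> D\<^sub>2 \<inter> realizations M p. \<exists>a \<in> D\<^sub>1 \<inter> realizations M p. semi_isolates L M b a"
  shows "(\<exists>R. definable_rel L M e R \<and> preorder_on (univ M) R \<and>
            \<not> (\<exists>a \<in> D\<^sub>1 \<inter> realizations M p. \<exists>c \<in> D\<^sub>1. (a, c) \<in> R \<and> maximal_in R D\<^sub>1 c))
         \<and> strict_order_property L M"
proof -
  let ?A = "D\<^sub>1 \<inter> realizations M p" and ?B = "D\<^sub>2 \<inter> realizations M p" and ?Q = "SI L M p"
  have saturated: "saturated L \<kappa> M" "natLeq \<le>o \<kappa>"
    using assms(3) by (auto simp: monster_model_def ordLess_imp_ordLeq)
  have "SI_bar L M p \<inter> ?A \<times> ?B = SI_bar L M p \<inter> (D\<^sub>1 \<times> D\<^sub>2)"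
    by (auto simp: SI_bar_def)
  then have "definable_rel L M e (SI_bar L M p \<inter> ?A \<times> ?B)"
    using assms(7,8,10) definable_rel_Int definable_rel_Times by metis
  then obtain G where G: "definable_rel L M e G"
    and between: "(?Q - ?Q\<inverse>) \<inter> ?A \<times> ?B \<subseteq> G" "G \<subseteq> ?Q \<inter> ?A \<times> ?B"
    using definable_rel_between_strict_SI_and_SI[OF saturated assms(4,6)] by blast
  have ascend: "\<exists>b\<in>?B. (a, b) \<in> ?Q - ?Q\<inverse>" if "a \<in> ?A" for a
    using assms(11) that by (fastforce simp: SI_def strictly_semi_isolates_def)
  have return: "\<exists>a\<in>?A. (b, a) \<in> ?Q" if "b \<in> ?B" for b
    using assms(12) that by (fastforce simp: SI_def)
  have Domain: "Domain G = ?A"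
    using between ascend by blast
  have descent: "\<exists>a'\<in>?A. G `` {a'} \<subset> G `` {a}" if "a \<in> ?A" for a
    using ex_Image_psubset_if_alternating[OF trans_SI between ascend return that] .
  have A: "?A \<subseteq> univ M" "?A \<noteq> {}"
    using assms(9) by (auto simp: realizations_def SI_bar_def)
  have "\<not> maximal_in (reverse_Image_order (univ M) G) D\<^sub>1 c"
    if "a \<in> ?A" "(a, c) \<in> reverse_Image_order (univ M) G" for a c
    using not_maximal_in_reverse_Image_order[of G] descent A(1) that unfolding Domain by blast
  then show ?thesis
    using definable_rel_reverse_Image_order[OF G] preorder_on_reverse_Image_order
      strict_order_property_if_no_minimal_Image[OF G assms(6) A descent] by blast
qed

end
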